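(* Let $f,g\in\mathrm{Diffeo}^-(\mathbb{R})$ with $f(0)=g(0)=0$ and $f\circ f=g\circ g$. Then there exists $h\in\mathrm{Diffeo}^+(\mathbb{R})$ with $h(0)=0$, commuting with $f\circ f$, such that $T_0 f=(T_0h)^{-1}\circ (T_0g)\circ (T_0h)$ if and only if one of the following holds: 1. $(T_0f)\circ(T_0f)\neq X$; 2. $0$ is an interior point of the fixed-point set $\mathrm{fix}(f\circ f)=\{x\in\mathbb{R}: f(f(x))=x\}$; 3. $(T_0f)\circ(T_0 f)=X$, $0$ is a boundary point of $\mathrm{fix}(f\circ f)$, and $T_0f=T_0g$.
   Context: $\mathrm{Diffeo}(\mathbb{R})$ is the group of $C^\infty$ diffeomorphisms of $\mathbb{R}$ under composition; $\mathrm{Diffeo}^+(\mathbb{R})$ (resp. $\mathrm{Diffeo}^-(\mathbb{R})$) is the set of orientation-preserving (resp. orientation-reversing) diffeomorphisms. For a diffeomorphism $\phi$ with $\phi(0)=0$, $T_0\phi=\phi'(0)X+\frac{\phi''(0)}{2}X^2+\cdots$ is its Taylor series at $0$, an element of the group of formally invertible real formal power series in $X$ (zero constant term, nonzero linear coefficient) under formal composition; $X$ denotes the identity series and $^{-1}$ the compositional inverse. *)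

theory Defs
  imports "HOL-Analysis.Analysis" "HOL-Computational_Algebra.Formal_Power_Series"
begin

definition smooth :: "(real \<Rightarrow> real) \<Rightarrow> bool" where
  "smooth f \<longleftrightarrow> (\<exists>D :: nat \<Rightarrow> real \<Rightarrow> real. D 0 = f \<and>
      (\<forall>n x. (D n has_real_derivative D (Suc n) x) (at x)))"

definition diffeo :: "(real \<Rightarrow> real) \<Rightarrow> bool" where
  "diffeo f \<longleftrightarrow> bij f \<and> smooth f \<and> smooth (inv f)"

definition diffeo_plus :: "(real \<Rightarrow> real) \<Rightarrow> bool" where
  "diffeo_plus f \<longleftrightarrow> diffeo f \<and> strict_mono f"

definition diffeo_minus :: "(real \<Rightarrow> real) \<Rightarrow> bool" where
  "diffeo_minus f \<longleftrightarrow> diffeo f \<and> (\<forall>x y. x < y \<longrightarrow> f y < f x)"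

definition taylor0 :: "(real \<Rightarrow> real) \<Rightarrow> real fps" where
  "taylor0 f = Abs_fps (\<lambda>n. (deriv ^^ n) f 0 / fact n)"

end

theory Submission
  imports Defs
begin

text \<open>
  Put \<open>\<phi> = f \<circ> f = g \<circ> g\<close>. If \<open>T\<^sub>0 \<phi> \<noteq> X\<close>, then comparing leading coefficients shows that \<open>T\<^sub>0 \<phi>\<close> has at
  most one compositional square root with negative linear coefficient, so \<open>T\<^sub>0 f = T\<^sub>0 g\<close> and \<open>h = id\<close>
  works. If \<open>\<phi>\<close> is the identity near \<open>0\<close>, then \<open>f\<close> and \<open>g\<close> are both conjugate to \<open>x \<mapsto> - x\<close> near \<open>0\<close>, by
  diffeomorphisms that can be chosen to be the identity outside the region where \<open>\<phi> = id\<close> and hence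
  commute with \<open>\<phi>\<close>. Conversely, if \<open>T\<^sub>0 \<phi> = X\<close> and \<open>h\<close> commutes with \<open>\<phi>\<close> but \<open>T\<^sub>0 h \<noteq> X\<close>, then \<open>h\<close> or its
  inverse contracts towards \<open>0\<close> at a rate of finite order, which forces the flat displacement
  \<open>\<phi> - id\<close> to vanish near \<open>0\<close>.
\<close>

unbundle no vec_syntax
unbundle fps_syntax

section \<open>Smooth functions\<close>

text \<open>An inductive counterpart of \<open>smooth\<close>: peeling off one derivative at a time
  lets the sum, product and chain rules be proved by induction on \<open>n\<close>, without formulas
  for higher derivatives.\<close>

primrec diff_times :: "nat \<Rightarrow> (real \<Rightarrow> real) \<Rightarrow> bool" where
  "diff_times 0 f \<longleftrightarrow> True"
| "diff_times (Suc n) f \<longleftrightarrow>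
     (\<exists>f'. (\<forall>x. (f has_real_derivative f' x) (at x)) \<and> diff_times n f')"

lemma diff_timesI:
  assumes "\<And>x. (f has_real_derivative f' x) (at x)" "diff_times n f'"
  shows "diff_times (Suc n) f"
  using assms by auto

lemma diff_times_SucD:
  assumes "diff_times (Suc n) f"
  shows "(f has_real_derivative deriv f x) (at x)" "diff_times n (deriv f)"
proof -
  obtain f' where f': "\<forall>x. (f has_real_derivative f' x) (at x)" "diff_times n f'"
    using assms unfolding diff_times.simps by blast
  moreover have "deriv f = f'"
    using f' DERIV_imp_deriv by blast
  ultimately show "(f has_real_derivative deriv f x) (at x)" "diff_times n (deriv f)"
    by simp_all
qed

lemma diff_times_Suc_imp: "diff_times (Suc n) f \<Longrightarrow> diff_times n f"
proof (induction n arbitrary: f)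
  case (Suc n)
  show ?case
    by (rule diff_timesI[of _ "deriv f"]) (use Suc diff_times_SucD in blast)+
qed simp

text \<open>Uniqueness of derivatives makes the witnesses for different \<open>n\<close> coherent,
  so the iterates of \<open>deriv\<close> form the sequence that \<open>smooth\<close> asks
  for.\<close>

lemma smooth_iff_diff_times: "smooth f \<longleftrightarrow> (\<forall>n. diff_times n f)"
proof
  assume "smooth f"
  then obtain D where D: "D 0 = f" "\<And>n x. (D n has_real_derivative D (Suc n) x) (at x)"
    unfolding smooth_def by blast
  have "diff_times n (D m)" for n m
    by (induction n arbitrary: m) (use D in \<open>auto intro: diff_timesI\<close>)
  with D show "\<forall>n. diff_times n f" by metis
next
  assume f: "\<forall>n. diff_times n f"
  have *: "diff_times k ((deriv ^^ n) f)" for n k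
    by (induction n arbitrary: k) (use f in \<open>auto intro: diff_times_SucD\<close>)
  have "((deriv ^^ n) f has_real_derivative (deriv ^^ Suc n) f x) (at x)" for n x
    using diff_times_SucD(1)[OF *[of "Suc 0" n]] by simp
  then show "smooth f"
    unfolding smooth_def by (intro exI[of _ "\<lambda>n. (deriv ^^ n) f"]) auto
qed

lemma smooth_has_deriv: "smooth f \<Longrightarrow> (f has_real_derivative deriv f x) (at x)"
  unfolding smooth_def using DERIV_imp_deriv by metis

lemma smooth_deriv: "smooth f \<Longrightarrow> smooth (deriv f)"
  by (simp add: smooth_iff_diff_times diff_times_SucD)

lemma smooth_isCont: "smooth f \<Longrightarrow> isCont f x"
  using smooth_has_deriv DERIV_isCont by blast

section \<open>Closure properties of repeated differentiability and smoothness\<close>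

lemma diff_times_const: "diff_times n (\<lambda>x. c)"
  by (induction n arbitrary: c) (auto intro!: derivative_eq_intros diff_timesI[of _ "\<lambda>x. 0"])

lemma diff_times_add:
  "diff_times n f \<Longrightarrow> diff_times n g \<Longrightarrow> diff_times n (\<lambda>x. f x + g x)"
proof (induction n arbitrary: f g)
  case (Suc n)
  note d = Suc.prems[THEN diff_times_SucD(1)] Suc.prems[THEN diff_times_SucD(2)]
  show ?case
  proof (rule diff_timesI[of _ "\<lambda>x. deriv f x + deriv g x"])
    show "diff_times n (\<lambda>x. deriv f x + deriv g x)"
      by (intro d Suc.IH)
  qed (auto intro!: derivative_eq_intros d)
qed simp

lemma diff_times_mult:
  "diff_times n f \<Longrightarrow> diff_times n g \<Longrightarrow> diff_times n (\<lambda>x. f x * g x)"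
proof (induction n arbitrary: f g)
  case (Suc n)
  note d = Suc.prems[THEN diff_times_SucD(1)] Suc.prems[THEN diff_times_SucD(2)]
  show ?case
  proof (rule diff_timesI[of _ "\<lambda>x. deriv f x * g x + deriv g x * f x"])
    show "((\<lambda>x. f x * g x) has_real_derivative deriv f x * g x + deriv g x * f x) (at x)" for x
      by (rule DERIV_mult) (rule d)+
    show "diff_times n (\<lambda>x. deriv f x * g x + deriv g x * f x)"
      by (rule diff_times_add; rule Suc.IH)
         (rule d Suc.prems[THEN diff_times_Suc_imp])+
  qed
qed simp

lemma diff_times_compose:
  "diff_times n f \<Longrightarrow> diff_times n g \<Longrightarrow> diff_times n (\<lambda>x. f (g x))"
proof (induction n arbitrary: f g)
  case (Suc n)
  note d = Suc.prems[THEN diff_times_SucD(1)] Suc.prems[THEN diff_times_SucD(2)]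
  show ?case
  proof (rule diff_timesI[of _ "\<lambda>x. deriv f (g x) * deriv g x"])
    show "((\<lambda>x. f (g x)) has_real_derivative deriv f (g x) * deriv g x) (at x)" for x
      by (rule DERIV_chain2) (rule d)+
    have "diff_times n (\<lambda>x. deriv f (g x))"
      by (rule Suc.IH) (rule d Suc.prems[THEN diff_times_Suc_imp])+
    then show "diff_times n (\<lambda>x. deriv f (g x) * deriv g x)"
      by (rule diff_times_mult) (rule d)
  qed
qed simp

lemma diff_times_inverse:
  "(\<And>x. f x \<noteq> 0) \<Longrightarrow> diff_times n f \<Longrightarrow> diff_times n (\<lambda>x. inverse (f x))"
proof (induction n)
  case (Suc n)
  note d = diff_times_SucD[OF Suc.prems(2)]
  have inv: "diff_times n (\<lambda>x. inverse (f x))"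
    using Suc diff_times_Suc_imp by blast
  show ?case
  proof (rule diff_timesI[of _ "\<lambda>x. (-1) * (inverse (f x) * (deriv f x * inverse (f x)))"])
    show "diff_times n (\<lambda>x. (-1) * (inverse (f x) * (deriv f x * inverse (f x))))"
      by (intro diff_times_mult diff_times_const inv d)
  qed (use d Suc.prems in \<open>auto intro!: derivative_eq_intros simp: algebra_simps\<close>)
qed simp

lemma smoothI:
  assumes "\<And>x. (f has_real_derivative f' x) (at x)" "smooth f'"
  shows "smooth f"
  unfolding smooth_iff_diff_times
proof
  show "diff_times n f" for n
    using assms by (cases n) (auto simp: smooth_iff_diff_times)
qed

lemma smooth_const [simp]: "smooth (\<lambda>x. c)"
  by (simp add: smooth_iff_diff_times diff_times_const)

lemma smooth_ident [simp]: "smooth (\<lambda>x. x)"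
  by (rule smoothI[of _ "\<lambda>x. 1"]) auto

lemma smooth_add: "smooth f \<Longrightarrow> smooth g \<Longrightarrow> smooth (\<lambda>x. f x + g x)"
  by (simp add: smooth_iff_diff_times diff_times_add)

lemma smooth_mult: "smooth f \<Longrightarrow> smooth g \<Longrightarrow> smooth (\<lambda>x. f x * g x)"
  by (simp add: smooth_iff_diff_times diff_times_mult)

lemma smooth_compose: "smooth f \<Longrightarrow> smooth g \<Longrightarrow> smooth (\<lambda>x. f (g x))"
  by (simp add: smooth_iff_diff_times diff_times_compose)

lemma smooth_inverse: "(\<And>x. f x \<noteq> 0) \<Longrightarrow> smooth f \<Longrightarrow> smooth (\<lambda>x. inverse (f x))"
  by (simp add: smooth_iff_diff_times diff_times_inverse)

lemma smooth_minus: "smooth f \<Longrightarrow> smooth (\<lambda>x. - f x)"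
  using smooth_mult[of "\<lambda>x. -1" f] by simp

lemma smooth_diff: "smooth f \<Longrightarrow> smooth g \<Longrightarrow> smooth (\<lambda>x. f x - g x)"
  using smooth_add[of f "\<lambda>x. - g x"] by (simp add: smooth_minus)

text \<open>Bootstrapping: the derivative of \<open>inv f\<close> is the reciprocal of
  \<open>deriv f\<close> at \<open>inv f\<close>, so \<open>n\<close> derivatives of
  \<open>inv f\<close> yield one more.\<close>

lemma smooth_inv:
  assumes "bij f" "smooth f" "\<And>x. deriv f x \<noteq> 0"
  shows "smooth (inv f)"
  unfolding smooth_iff_diff_times
proof
  have der: "(inv f has_real_derivative inverse (deriv f (inv f x))) (at x)" for x
  proof -
    have f_inv: "f (inv f y) = y" for y
      using assms(1) by (simp add: bij_is_surj surj_f_inv_f)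
    have "isCont (inv f) (f (inv f x))"
      by (rule isCont_inverse_function[of 1])
         (simp_all add: smooth_isCont[OF assms(2)] bij_is_inj[OF assms(1)])
    then have "isCont (inv f) x" by (simp only: f_inv)
    then show ?thesis
      using smooth_has_deriv[OF assms(2)] assms(3)
      by (intro DERIV_inverse_function[where f=f and a="x - 1" and b="x + 1"]) (simp_all add: f_inv)
  qed
  show "diff_times n (inv f)" for n
  proof (induction n)
    case (Suc n)
    have "diff_times n (deriv f)"
      using assms(2) by (simp add: smooth_iff_diff_times diff_times_SucD)
    then have "diff_times n (\<lambda>x. deriv f (inv f x))"
      using Suc by (rule diff_times_compose)
    with assms(3) have "diff_times n (\<lambda>x. inverse (deriv f (inv f x)))"
      by (rule diff_times_inverse)
    with der show ?case by (rule diff_timesI)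
  qed simp
qed

section \<open>Taylor series at the origin\<close>

lemma taylor0_nth_0 [simp]: "taylor0 f $ 0 = f 0"
  by (simp add: taylor0_def)

lemma taylor0_nth_1: "taylor0 f $ Suc 0 = deriv f 0"
  by (simp add: taylor0_def)

lemma fps_deriv_taylor0: "fps_deriv (taylor0 f) = taylor0 (deriv f)"
  by (rule fps_ext) (simp add: taylor0_def funpow_Suc_right del: funpow.simps)

lemma taylor0_nth_Suc: "taylor0 f $ Suc n = taylor0 (deriv f) $ n / real (Suc n)"
  by (simp flip: fps_deriv_taylor0 del: of_nat_Suc)

lemma taylor0_cong:
  assumes "eventually (\<lambda>x. f x = g x) (nhds 0)"
  shows "taylor0 f = taylor0 g"
  by (rule fps_ext) (simp add: taylor0_def higher_deriv_cong_ev[OF assms])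

lemma deriv_mult:
  assumes "smooth f" "smooth g"
  shows "deriv (\<lambda>x. f x * g x) = (\<lambda>x. deriv f x * g x + f x * deriv g x)"
  by (intro ext DERIV_imp_deriv) (auto intro!: derivative_eq_intros smooth_has_deriv assms)

lemma deriv_add_smooth:
  assumes "smooth f" "smooth g"
  shows "deriv (\<lambda>x. f x + g x) = (\<lambda>x. deriv f x + deriv g x)"
  by (intro ext DERIV_imp_deriv) (auto intro!: derivative_eq_intros smooth_has_deriv assms)

lemma deriv_compose_smooth:
  assumes "smooth f" "smooth g"
  shows "deriv (\<lambda>x. f (g x)) = (\<lambda>x. deriv f (g x) * deriv g x)"
  by (intro ext DERIV_imp_deriv DERIV_chain2 smooth_has_deriv assms)

lemma taylor0_add:
  assumes "smooth f" "smooth g"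
  shows "taylor0 (\<lambda>x. f x + g x) = taylor0 f + taylor0 g"
proof (rule fps_ext)
  show "taylor0 (\<lambda>x. f x + g x) $ n = (taylor0 f + taylor0 g) $ n" for n
    using assms
    by (induction n arbitrary: f g)
       (simp_all add: taylor0_nth_Suc deriv_add_smooth smooth_deriv add_divide_distrib)
qed

lemma taylor0_const: "taylor0 (\<lambda>x. c) = fps_const c"
proof (rule fps_ext)
  have "taylor0 (\<lambda>x. 0) $ n = 0" for n
    by (induction n) (simp_all add: taylor0_nth_Suc)
  then show "taylor0 (\<lambda>x. c) $ n = fps_const c $ n" for n
    by (cases n) (simp_all add: taylor0_nth_Suc)
qed

lemma taylor0_ident: "taylor0 (\<lambda>x. x) = fps_X"
proof (rule fps_ext)
  show "taylor0 (\<lambda>x. x) $ n = fps_X $ n" for n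
    by (cases n) (simp_all add: taylor0_nth_Suc taylor0_const fps_X_def)
qed

lemma taylor0_mult:
  assumes "smooth f" "smooth g"
  shows "taylor0 (\<lambda>x. f x * g x) = taylor0 f * taylor0 g"
proof (rule fps_ext)
  show "taylor0 (\<lambda>x. f x * g x) $ n = (taylor0 f * taylor0 g) $ n" for n
    using assms
  proof (induction n arbitrary: f g)
    case (Suc n)
    have "(taylor0 f * taylor0 g) $ Suc n =
        fps_deriv (taylor0 f * taylor0 g) $ n / real (Suc n)"
      by (simp del: of_nat_Suc fps_deriv_mult)
    also have "fps_deriv (taylor0 f * taylor0 g) $ n =
        taylor0 (\<lambda>x. deriv f x * g x + f x * deriv g x) $ n"
      using Suc by (simp add: fps_deriv_taylor0 taylor0_add smooth_mult smooth_deriv)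
    finally show ?case
      using Suc.prems by (simp add: taylor0_nth_Suc deriv_mult)
  qed simp
qed

text \<open>By the chain rule on both sides, coefficient \<open>n\<close> reduces to a Cauchy
  product using all lower coefficients of \<open>deriv f\<close> composed with \<open>g\<close>;
  hence the strong induction.\<close>

lemma taylor0_compose:
  assumes "smooth f" "smooth g" "g 0 = 0"
  shows "taylor0 (\<lambda>x. f (g x)) = taylor0 f oo taylor0 g"
proof (rule fps_ext)
  show "taylor0 (\<lambda>x. f (g x)) $ n = (taylor0 f oo taylor0 g) $ n" for n
    using assms
  proof (induction n arbitrary: f rule: less_induct)
    case (less n)
    show ?case
    proof (cases n)
      case (Suc m)
      have IH: "taylor0 (\<lambda>x. deriv f (g x)) $ i = (taylor0 (deriv f) oo taylor0 g) $ i"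
        if "i \<le> m" for i
        using that Suc less by (simp add: smooth_deriv)
      have "(taylor0 f oo taylor0 g) $ n =
          fps_deriv (taylor0 f oo taylor0 g) $ m / real (Suc m)"
        by (simp add: Suc del: of_nat_Suc)
      also have "fps_deriv (taylor0 f oo taylor0 g) =
          (taylor0 (deriv f) oo taylor0 g) * taylor0 (deriv g)"
        using less.prems by (simp add: fps_compose_deriv fps_deriv_taylor0)
      also have "\<dots> $ m = (taylor0 (\<lambda>x. deriv f (g x)) * taylor0 (deriv g)) $ m"
        by (simp add: fps_mult_nth IH)
      also have "\<dots> = taylor0 (deriv (\<lambda>x. f (g x))) $ m"
        using less.prems
        by (simp add: deriv_compose_smooth taylor0_mult smooth_compose smooth_deriv)
      finally show ?thesis by (simp add: Suc taylor0_nth_Suc)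
    qed (simp add: less.prems)
  qed
qed

text \<open>Iterated l'Hopital. This turns formal leading coefficients into asymptotics at
  \<open>0\<close>.\<close>

lemma taylor0_peano:
  assumes "smooth r" "\<And>i. i < k \<Longrightarrow> taylor0 r $ i = 0"
  shows "((\<lambda>x. r x / x ^ k) \<longlongrightarrow> taylor0 r $ k) (at 0)"
  using assms
proof (induction k arbitrary: r)
  case 0
  then show ?case using smooth_isCont[of r 0] by (simp add: isCont_def)
next
  case (Suc k)
  have r': "taylor0 (deriv r) $ i = 0" if "i < k" for i
    using Suc.prems(2)[of "Suc i"] that by (simp add: taylor0_nth_Suc)
  show ?case
  proof (rule lhopital)
    show "(r \<longlongrightarrow> 0) (at 0)"
      using smooth_isCont[OF Suc.prems(1), of 0] Suc.prems(2)[of 0] by (simp add: isCont_def)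
    show "((\<lambda>x. x ^ Suc k) \<longlongrightarrow> 0) (at (0::real))"
      by (auto intro!: tendsto_eq_intros)
    have neq: "\<forall>\<^sub>F x in at 0. x \<noteq> (0::real)"
      by (rule eventually_neq_at_within)
    show "\<forall>\<^sub>F x in at 0. x ^ Suc k \<noteq> (0::real)"
      by (rule eventually_mono[OF neq]) simp
    show "\<forall>\<^sub>F x in at 0. real (Suc k) * x ^ k \<noteq> 0"
      by (rule eventually_mono[OF neq]) (simp del: of_nat_Suc)
    show "\<forall>\<^sub>F x in at 0. (r has_real_derivative deriv r x) (at x)"
      using Suc.prems by (simp add: smooth_has_deriv)
    show "\<forall>\<^sub>F x::real in at 0. ((\<lambda>x. x ^ Suc k) has_real_derivative real (Suc k) * x ^ k) (at x)"
      using DERIV_pow[of "Suc k"] by (simp del: power_Suc of_nat_Suc)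
    have "((\<lambda>x. (deriv r x / x ^ k) / real (Suc k)) \<longlongrightarrow>
        taylor0 (deriv r) $ k / real (Suc k)) (at 0)"
      using Suc.prems r' by (intro tendsto_divide Suc.IH smooth_deriv) auto
    then show "((\<lambda>x. deriv r x / (real (Suc k) * x ^ k)) \<longlongrightarrow> taylor0 r $ Suc k) (at 0)"
      by (simp add: taylor0_nth_Suc mult.commute del: of_nat_Suc)
  qed
qed

section \<open>Formal power series\<close>

text \<open>\<open>B - A\<close> divides every \<open>B ^ i - A ^ i\<close>, so the powers entering
  the coefficients below \<open>m\<close> agree.\<close>

lemma fps_X_power_dvd_compose_diff:
  fixes q A B :: "'a :: comm_ring_1 fps"
  assumes "fps_X ^ m dvd B - A"
  shows "fps_X ^ m dvd (q oo B) - (q oo A)"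
proof -
  have low: "(B ^ i) $ n = (A ^ i) $ n" if "n < m" for n i
  proof -
    have "B - A dvd B ^ i - A ^ i"
      by (cases i) (simp_all only: diff_power_eq_sum power_0 diff_self dvd_0_right dvd_triv_left)
    with assms obtain c where "B ^ i - A ^ i = fps_X ^ m * c"
      by (metis dvd_trans dvdE)
    then have "(B ^ i - A ^ i) $ n = 0" using that by (simp add: fps_X_power_mult_nth)
    then show ?thesis by simp
  qed
  define e where "e = (q oo B) - (q oo A)"
  have "e $ n = 0" if "n < m" for n
    using that by (simp add: e_def fps_compose_nth low)
  then have "e = fps_X ^ m * fps_shift m e"
    by (intro fps_ext) (simp add: fps_X_power_mult_nth)
  then show ?thesis by (metis e_def dvd_triv_left)
qed

text \<open>First-order expansion of \<open>q\<close> at \<open>A\<close>: to leading order the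
  difference is \<open>q'(A) * (B - A)\<close>, where \<open>q'\<close> starts with
  \<open>Suc j * w $ 0 * X ^ j\<close> and \<open>A\<close> with
  \<open>\<alpha> * X\<close>.\<close>

lemma fps_compose_diff_leading_coeff:
  fixes q w u A B :: "'a :: idom fps"
  assumes "A $ 0 = 0" "B $ 0 = 0" "A $ 1 = \<alpha>" "B $ 1 = \<alpha>" "B - A = fps_X ^ m * u"
    and q: "q = fps_X ^ Suc j * w"
  shows "((q oo B) - (q oo A)) $ (m + j) = of_nat (Suc j) * w $ 0 * \<alpha> ^ j * u $ 0"
proof -
  obtain a where a: "A = fps_X * a" "a $ 0 = \<alpha>"
  proof
    show "A = fps_X * fps_shift 1 A" using assms(1) by (intro fps_ext) (auto simp: fps_X_mult_nth)
  qed (use assms in simp)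
  obtain b where b: "B = fps_X * b" "b $ 0 = \<alpha>"
  proof
    show "B = fps_X * fps_shift 1 B" using assms(2) by (intro fps_ext) (auto simp: fps_X_mult_nth)
  qed (use assms in simp)
  obtain v where v: "(w oo B) - (w oo A) = fps_X ^ m * v"
    using fps_X_power_dvd_compose_diff[of m B A w] assms(5) by (metis dvd_triv_left dvdE)
  define S where "S = (\<Sum>p<Suc j. b ^ p * a ^ (j - p))"
  have "B ^ Suc j - A ^ Suc j = (B - A) * (\<Sum>p<Suc j. B ^ p * A ^ (j - p))"
    by (rule diff_power_eq_sum)
  also have "(\<Sum>p<Suc j. B ^ p * A ^ (j - p)) = fps_X ^ j * S"
    unfolding S_def sum_distrib_left
  proof (rule sum.cong)
    fix p assume "p \<in> {..<Suc j}"
    then have "fps_X ^ j = fps_X ^ p * (fps_X ^ (j - p) :: 'a fps)"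
      by (simp flip: power_add)
    then show "B ^ p * A ^ (j - p) = fps_X ^ j * (b ^ p * a ^ (j - p))"
      by (simp add: a b power_mult_distrib mult_ac)
  qed simp
  finally have BA: "B ^ Suc j - A ^ Suc j = fps_X ^ (m + j) * (u * S)"
    using assms(5) by (simp add: power_add mult_ac)
  have "(q oo B) - (q oo A) = B ^ Suc j * (w oo B) - A ^ Suc j * (w oo A)"
    using assms(1,2)
    by (simp add: q fps_compose_mult_distrib fps_X_power_compose del: power_Suc)
  \<comment> \<open>The second summand has order at least \<open>m + j + 1\<close>, so only the
    first reaches coefficient \<open>m + j\<close>.\<close>
  also have "\<dots> = (B ^ Suc j - A ^ Suc j) * (w oo B) + A ^ Suc j * ((w oo B) - (w oo A))"
    by (simp add: algebra_simps)
  also have "\<dots> = fps_X ^ (m + j) * (u * S * (w oo B) + fps_X * (a ^ Suc j * v))"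
    unfolding BA v by (simp add: a power_mult_distrib power_add algebra_simps)
  finally have "((q oo B) - (q oo A)) $ (m + j) = u $ 0 * S $ 0 * w $ 0"
    by (simp add: fps_X_power_mult_nth)
  also have "S $ 0 = (\<Sum>p<Suc j. \<alpha> ^ j)"
    unfolding S_def fps_sum_nth
    by (intro sum.cong) (auto simp: a b fps_power_zeroth simp flip: power_add)
  finally show ?thesis by (simp add: mult_ac)
qed

lemma fps_subdegree_decompose:
  fixes D :: "'a :: idom fps"
  assumes "D \<noteq> 0" "\<And>i. i < n \<Longrightarrow> D $ i = 0"
  obtains m u where "n \<le> m" "D = fps_X ^ m * u" "u $ 0 \<noteq> 0"
proof
  show "n \<le> subdegree D" using assms by (meson not_less nth_subdegree_nonzero)
  show "D = fps_X ^ subdegree D * fps_shift (subdegree D) D"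
    using subdegree_decompose[of D] by (simp add: mult.commute)
  show "fps_shift (subdegree D) D $ 0 \<noteq> 0" using assms by simp
qed

text \<open>
  If \<open>G = F + c X\<^sup>m + \<dots>\<close> with \<open>c \<noteq> 0\<close>, then comparing \<open>F \<circ> F\<close> with \<open>G \<circ> G\<close> forces \<open>F = - X + \<dots>\<close> and
  \<open>m\<close> even. If the common square is \<open>P = X + a X\<^sup>k + \<dots>\<close> with \<open>a \<noteq> 0\<close>, then \<open>F \<circ> P = P \<circ> F\<close> forces \<open>k\<close>
  odd, and the difference of \<open>G \<circ> P = P \<circ> G\<close> and \<open>F \<circ> P = P \<circ> F\<close> forces \<open>m = k\<close>.
\<close>
lemma fps_reversing_square_root_unique:
  fixes F G :: "real fps"
  assumes FG: "F $ 0 = 0" "G $ 0 = 0" "F $ 1 < 0" "G $ 1 < 0"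
    and sq: "F oo F = G oo G" and nontriv: "F oo F \<noteq> fps_X"
  shows "F = G"
proof (rule ccontr)
  assume "F \<noteq> G"
  have sq1: "(H oo H) $ 1 = (H $ 1)\<^sup>2" if "H $ 0 = 0" for H :: "real fps"
    by (simp add: fps_compose_nth power2_eq_square)
  have 1: "F $ 1 = G $ 1"
    using sq1[of F] sq1[of G] FG sq by (auto simp: power2_eq_iff)
  define \<beta> where "\<beta> = F $ 1"
  have "G - F \<noteq> 0" using \<open>F \<noteq> G\<close> by simp
  then obtain m u where m: "2 \<le> m" and D: "G - F = fps_X ^ m * u" and u: "u $ 0 \<noteq> 0"
    by (rule fps_subdegree_decompose[of _ 2]) (use FG 1 in \<open>auto simp: less_2_cases_iff\<close>)
  obtain g where g: "G = fps_X * g" "g $ 0 = \<beta>"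
  proof
    show "G = fps_X * fps_shift 1 G" using FG by (intro fps_ext) (auto simp: fps_X_mult_nth)
  qed (use 1 in \<open>simp add: \<beta>_def\<close>)
  obtain w where w: "F = fps_X * w" "w $ 0 = \<beta>"
  proof
    show "F = fps_X * fps_shift 1 F" using FG by (intro fps_ext) (auto simp: fps_X_mult_nth)
  qed (simp add: \<beta>_def)

  \<comment> \<open>Changing first the outer and then the inner series splits coefficient
    \<open>m\<close> into \<open>\<beta> ^ m * u $ 0\<close> and
    \<open>\<beta> * u $ 0\<close>.\<close>
  have "0 = (G oo G) - (F oo F)" by (simp add: sq)
  also have "\<dots> = ((G - F) oo G) + ((F oo G) - (F oo F))"
    by (simp add: fps_compose_sub_distrib)
  finally have "0 $ m = (((G - F) oo G) + ((F oo G) - (F oo F))) $ m"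
    by (rule arg_cong)
  then have "0 = ((G - F) oo G) $ m + ((F oo G) - (F oo F)) $ m"
    by (simp only: fps_add_nth fps_zero_nth)
  also have "((F oo G) - (F oo F)) $ m = \<beta> * u $ 0"
    using fps_compose_diff_leading_coeff[OF FG(1,2) refl 1[symmetric] D, of F 0 w] w by simp
  also have "((G - F) oo G) = fps_X ^ m * (g ^ m * (u oo G))"
    unfolding D using FG g(1)
    by (simp add: fps_compose_mult_distrib fps_X_power_compose power_mult_distrib mult_ac)
  also have "(fps_X ^ m * (g ^ m * (u oo G))) $ m = \<beta> ^ m * u $ 0"
    by (simp add: fps_X_power_mult_nth fps_power_zeroth g)
  finally have "(\<beta> ^ m + \<beta>) * u $ 0 = 0" by (simp add: algebra_simps)
  then have \<beta>m: "\<beta> ^ m = - \<beta>" using u by simp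
  have "\<beta> < 0" using FG by (simp add: \<beta>_def)
  then have "\<not> \<beta> ^ m < 0" by (simp add: \<beta>m)
  then have "even m" using \<open>\<beta> < 0\<close> by (simp add: power_less_zero_eq)
  obtain l where l: "m = Suc l" "l \<noteq> 0" using m by (cases m) auto
  have "\<beta> * (\<beta> ^ l + 1) = 0" using \<beta>m by (simp add: l(1) algebra_simps)
  then have "\<beta> ^ l = - 1" using \<open>\<beta> < 0\<close> by (simp add: add_eq_0_iff2)
  then have "\<bar>\<beta>\<bar> = 1" using power_eq_1_iff[of "\<bar>\<beta>\<bar>" l] l(2) by (simp flip: power_abs)
  then have \<beta>: "\<beta> = -1" using \<open>\<beta> < 0\<close> by simp

  define P where "P = F oo F"
  have P: "P $ 0 = 0" "P $ 1 = 1" using sq1[of F] FG \<beta> by (simp_all add: P_def \<beta>_def)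
  have PF: "P oo F = F oo P"
    unfolding P_def by (rule fps_compose_assoc[symmetric]) (fact FG)+
  have PG: "P oo G = G oo P"
    unfolding P_def sq by (rule fps_compose_assoc[symmetric]) (fact FG)+
  have "P - fps_X \<noteq> 0" using nontriv by (simp add: P_def)
  then obtain k v where k: "2 \<le> k" and Q: "P - fps_X = fps_X ^ k * v" and v: "v $ 0 \<noteq> 0"
    by (rule fps_subdegree_decompose[of _ 2]) (use P in \<open>auto simp: less_2_cases_iff\<close>)
  define Q' where "Q' = P - fps_X"
  obtain i where i: "k = Suc i" using k by (cases k) auto

  \<comment> \<open>Commutation turns an outer perturbation into an inner one; the leading
    coefficients \<open>(-1) ^ k * v $ 0\<close> and \<open>- v $ 0\<close> must then agree.\<close>
  have "(Q' oo F) = (F oo P) - (F oo fps_X)"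
    using FG PF by (simp add: Q'_def fps_compose_sub_distrib fps_X_fps_compose_startby0)
  then have "(Q' oo F) $ k = ((F oo P) - (F oo fps_X)) $ k" by simp
  also have "\<dots> = - v $ 0"
    using fps_compose_diff_leading_coeff[OF _ P(1) _ P(2) Q, of F 0 w] w \<beta> by simp
  also have "(Q' oo F) = fps_X ^ k * (w ^ k * (v oo F))"
    unfolding Q'_def Q using FG w(1)
    by (simp add: fps_compose_mult_distrib fps_X_power_compose power_mult_distrib mult_ac)
  finally have "(-1) ^ k * v $ 0 = - v $ 0"
    by (simp add: fps_X_power_mult_nth fps_power_zeroth w \<beta>)
  then have "odd k" using v by (auto simp: minus_one_power_iff split: if_splits)

  \<comment> \<open>One series is expanded twice at index \<open>k + l = m + i\<close>: as
    \<open>G - F\<close> perturbed inside by \<open>P - X\<close>, and as \<open>P - X\<close>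
    perturbed inside by \<open>G - F\<close>. The factors \<open>m\<close> and \<open>k\<close> come
    from differentiating the outer leading powers.\<close>
  have "((G - F) oo P) - ((G - F) oo fps_X) = (Q' oo G) - (Q' oo F)"
    using FG P PF PG
    by (simp add: Q'_def fps_compose_sub_distrib fps_X_fps_compose_startby0)
  moreover have "(((G - F) oo P) - ((G - F) oo fps_X)) $ (k + l) = real m * (u $ 0 * v $ 0)"
    using fps_compose_diff_leading_coeff[OF _ P(1) _ P(2) Q, of "G - F" l u] D l(1) by simp
  moreover have "((Q' oo G) - (Q' oo F)) $ (m + i) = real k * (-1) ^ i * (u $ 0 * v $ 0)"
    using fps_compose_diff_leading_coeff[OF FG(1,2) refl 1[symmetric] D, of Q' i v] Q i \<beta>
    by (simp add: Q'_def \<beta>_def)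
  moreover have "k + l = m + i" by (simp add: i l(1))
  ultimately have "real m * (u $ 0 * v $ 0) = real k * (-1) ^ i * (u $ 0 * v $ 0)"
    by (simp only:)
  moreover have "even i" using \<open>odd k\<close> by (simp add: i)
  ultimately have "m = k" using u v by simp
  then show False using \<open>odd k\<close> \<open>even m\<close> by blast
qed

section \<open>Commuting with a flat diffeomorphism\<close>

text \<open>The orbit decreases to a limit in \<open>[0, \<epsilon>)\<close>, which is a fixed point
  by continuity, and \<open>h\<close> moves every positive point below
  \<open>\<epsilon>\<close>.\<close>

lemma iterates_of_contraction_tendsto_0:
  fixes h :: "real \<Rightarrow> real"
  assumes cont: "\<And>x. isCont h x" and h: "\<And>x. 0 < x \<Longrightarrow> x < \<epsilon> \<Longrightarrow> 0 < h x \<and> h x < x"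
    and x: "0 < x" "x < \<epsilon>"
  shows "0 < (h ^^ n) x \<and> (h ^^ n) x < \<epsilon>" and "(\<lambda>n. (h ^^ n) x) \<longlonglongrightarrow> 0"
proof -
  have pos: "0 < (h ^^ n) x \<and> (h ^^ n) x \<le> x" for n
    by (induction n) (use h x in \<open>auto simp: less_eq_real_def intro: less_trans\<close>)
  then show "0 < (h ^^ n) x \<and> (h ^^ n) x < \<epsilon>" for n
    using x by (meson le_less_trans)
  have dec: "decseq (\<lambda>n. (h ^^ n) x)"
    unfolding decseq_Suc_iff
  proof
    show "(h ^^ Suc n) x \<le> (h ^^ n) x" for n
      using h[of "(h ^^ n) x"] pos[of n] x by simp
  qed
  then obtain L where L: "(\<lambda>n. (h ^^ n) x) \<longlonglongrightarrow> L" "\<And>n. L \<le> (h ^^ n) x"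
    using decseq_convergent[of _ 0] pos less_imp_le by metis
  have "0 \<le> L" using LIMSEQ_le_const[OF L(1), of 0] pos less_imp_le by blast
  have "L < \<epsilon>" using L(2)[of 0] x by simp
  have "(\<lambda>n. h ((h ^^ n) x)) \<longlonglongrightarrow> h L"
    using isCont_tendsto_compose[OF cont L(1)] .
  moreover have "(\<lambda>n. (h ^^ Suc n) x) \<longlonglongrightarrow> L"
    by (rule LIMSEQ_Suc) (rule L(1))
  ultimately have "h L = L" using LIMSEQ_unique by fastforce
  then have "L = 0" using h[of L] \<open>0 \<le> L\<close> \<open>L < \<epsilon>\<close> by (cases "L = 0") auto
  then show "(\<lambda>n. (h ^^ n) x) \<longlonglongrightarrow> 0" using L(1) by simp
qed

text \<open>
  If \<open>h x = x - a x\<^sup>k + \<dots>\<close> with \<open>a > 0\<close>, then for \<open>N > k\<close> the quotient \<open>\<bar>\<phi> x - x\<bar> / x\<^sup>N\<close> does not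
  decrease when \<open>x\<close> is replaced by \<open>h x\<close>. It tends to \<open>0\<close> at \<open>0\<close> because \<open>\<phi>\<close> is flat, hence it
  vanishes identically.
\<close>
lemma flat_commuting_with_contraction:
  fixes \<phi> h :: "real \<Rightarrow> real"
  assumes \<phi>: "smooth \<phi>" "taylor0 \<phi> = fps_X"
    and h: "smooth h" "h 0 = 0" "0 < deriv h 0" "taylor0 h \<noteq> fps_X"
    and comm: "\<And>x. h (\<phi> x) = \<phi> (h x)"
    and contr: "0 < \<delta>" "\<And>x. 0 < x \<Longrightarrow> x < \<delta> \<Longrightarrow> 0 < h x \<and> h x < x"
  shows "\<exists>\<epsilon>>0. \<forall>x. 0 < x \<and> x < \<epsilon> \<longrightarrow> \<phi> x = x"
proof -
  define r where "r = (\<lambda>x. x - h x)"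
  have r: "smooth r" by (simp add: r_def h smooth_diff)
  have Tr: "taylor0 r = fps_X - taylor0 h"
    using taylor0_add[of r h] h r taylor0_ident by (simp add: r_def algebra_simps)
  then have "taylor0 r \<noteq> 0" using h(4) by simp
  then obtain k u where k: "1 \<le> k" and u: "taylor0 r = fps_X ^ k * u" "u $ 0 \<noteq> 0"
    by (rule fps_subdegree_decompose[of _ 1]) (simp add: r_def h)
  then obtain j where j: "k = Suc j" by (cases k) auto
  define a where "a = u $ 0"
  have low: "taylor0 r $ i = 0" if "i < k" for i
    using that by (simp add: u fps_X_power_mult_nth)
  have rk: "taylor0 r $ k = a" by (simp add: u fps_X_power_mult_nth a_def)
  have lim_r: "((\<lambda>x. r x / x ^ k) \<longlongrightarrow> a) (at_right 0)"
    using taylor0_peano[OF r low] rk by (metis filterlim_at_split)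
  have low': "taylor0 (deriv r) $ i = 0" if "i < j" for i
    using low[of "Suc i"] that by (simp add: taylor0_nth_Suc j)
  have lim_r': "((\<lambda>x. deriv r x / x ^ j) \<longlongrightarrow> real k * a) (at_right 0)"
  proof -
    have "taylor0 (deriv r) $ j = real k * a"
      using rk by (simp add: taylor0_nth_Suc j field_simps del: of_nat_Suc)
    then show ?thesis
      using taylor0_peano[OF smooth_deriv[OF r] low'] by (metis filterlim_at_split)
  qed
  have near: "\<forall>\<^sub>F x in at_right 0. 0 < x \<and> x < \<delta>"
    using contr(1) eventually_at_right_less[of 0] eventually_at_right_real[of 0 \<delta>]
    by (auto elim: eventually_mono)
  \<comment> \<open>The contraction makes \<open>r\<close> positive on the right of
    \<open>0\<close>, so its nonzero leading coefficient is positive.\<close>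
  have "0 < a"
  proof -
    have "\<forall>\<^sub>F x in at_right 0. 0 \<le> r x / x ^ k"
      using near by eventually_elim (use contr in \<open>auto simp: r_def less_imp_le\<close>)
    then have "0 \<le> a" using tendsto_lowerbound[OF lim_r] by simp
    then show ?thesis using u by (simp add: a_def)
  qed

  define \<rho> where "\<rho> = (\<lambda>x. h x / x)"
  \<comment> \<open>\<open>0 ^ j\<close> is \<open>1\<close> only for \<open>j = 0\<close>: the
    ratio \<open>h x / x\<close> tends to \<open>1 - a\<close>, which is \<open>h'(0)\<close>, when
    \<open>k = 1\<close>, and to \<open>1\<close> otherwise.\<close>
  define \<kappa> where "\<kappa> = 1 - a * 0 ^ j"
  have one_minus_\<rho>: "1 - \<rho> x = r x / x ^ k * x ^ j" if "x \<noteq> 0" for x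
    using that by (simp add: \<rho>_def r_def j field_simps)
  have lim_\<rho>: "(\<rho> \<longlongrightarrow> \<kappa>) (at_right 0)"
  proof -
    have "((\<lambda>x. 1 - (r x / x ^ k) * x ^ j) \<longlongrightarrow> \<kappa>) (at_right 0)"
      unfolding \<kappa>_def by (intro tendsto_intros lim_r)
    moreover have "\<forall>\<^sub>F x in at_right 0. 1 - (r x / x ^ k) * x ^ j = \<rho> x"
      using near
    proof eventually_elim
      case (elim x)
      then show ?case using one_minus_\<rho>[of x] by simp
    qed
    ultimately show ?thesis by (rule Lim_transform_eventually)
  qed
  define s where "s = (\<Sum>i<Suc k. \<kappa> ^ i)"
  \<comment> \<open>This strict gap is what the exponent \<open>Suc k\<close> provides:
    \<open>s\<close> is \<open>1 + h'(0)\<close> for \<open>k = 1\<close> and \<open>k + 1\<close>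
    for larger \<open>k\<close>.\<close>
  have "real k < s"
  proof (cases j)
    case 0
    have "deriv r 0 = 1 - deriv h 0"
      unfolding r_def by (rule DERIV_imp_deriv) (auto intro!: derivative_eq_intros smooth_has_deriv h)
    then have "\<kappa> = deriv h 0" using rk 0 by (simp add: \<kappa>_def j taylor0_nth_1)
    then show ?thesis using 0 h(3) by (simp add: s_def j)
  next
    case (Suc i)
    then show ?thesis by (simp add: s_def \<kappa>_def)
  qed
  have lim_\<rho>N: "((\<lambda>x. (1 - \<rho> x ^ Suc k) / x ^ j) \<longlongrightarrow> a * s) (at_right 0)"
  proof -
    have "((\<lambda>x. r x / x ^ k * (\<Sum>i<Suc k. \<rho> x ^ i)) \<longlongrightarrow> a * s) (at_right 0)"
      unfolding s_def by (intro tendsto_intros lim_r lim_\<rho>)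
    moreover have "\<forall>\<^sub>F x in at_right 0.
        r x / x ^ k * (\<Sum>i<Suc k. \<rho> x ^ i) = (1 - \<rho> x ^ Suc k) / x ^ j"
      using near
    proof eventually_elim
      case (elim x)
      have "1 - \<rho> x ^ Suc k = (1 - \<rho> x) * (\<Sum>i<Suc k. \<rho> x ^ i)"
        by (rule one_diff_power_eq)
      then show ?case using elim by (simp add: one_minus_\<rho>)
    qed
    ultimately show ?thesis by (rule Lim_transform_eventually)
  qed
  \<comment> \<open>Near \<open>0\<close>, \<open>deriv r \<xi>\<close> behaves like
    \<open>k * a * \<xi> ^ j\<close> and \<open>1 - \<rho> x ^ Suc k\<close> like
    \<open>a * s * x ^ j\<close>. Two constants in between leave room for a mean-value point
    \<open>\<xi>\<close> different from \<open>x\<close>.\<close>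
  obtain c1 where c1: "real k * a < c1" "c1 < a * s"
    using dense[of "real k * a" "a * s"] \<open>real k < s\<close> \<open>0 < a\<close> by (auto simp: mult.commute)
  then obtain c2 where c2: "c1 < c2" "c2 < a * s" using dense by blast
  have "0 < c1" using c1(1) \<open>0 < a\<close> by (smt (verit) mult_nonneg_nonneg of_nat_0_le_iff)

  have flat: "((\<lambda>x. (\<phi> x - x) / x ^ n) \<longlongrightarrow> 0) (at_right 0)" for n
  proof -
    have e: "smooth (\<lambda>x. \<phi> x - x)" by (simp add: \<phi> smooth_diff)
    have "taylor0 (\<lambda>x. \<phi> x - x) = 0"
      using taylor0_add[of "\<lambda>x. \<phi> x - x" "\<lambda>x. x"] e \<phi>(2) by (simp add: taylor0_ident)
    then show ?thesis
      using taylor0_peano[OF e, of n] by (simp add: filterlim_at_split)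
  qed

  have "\<forall>\<^sub>F x in at_right 0. deriv r x < c1 * x ^ j"
    using order_tendstoD(2)[OF lim_r' c1(1)] near
    by eventually_elim (simp add: pos_divide_less_eq)
  then obtain \<epsilon>1 where \<epsilon>1: "0 < \<epsilon>1" "\<And>x. 0 < x \<Longrightarrow> x < \<epsilon>1 \<Longrightarrow> deriv r x < c1 * x ^ j"
    by (auto simp: eventually_at_right_field)
  have "\<forall>\<^sub>F x in at_right 0. c2 * x ^ j < 1 - \<rho> x ^ Suc k"
    using order_tendstoD(1)[OF lim_\<rho>N c2(2)] near
    by eventually_elim (simp add: pos_less_divide_eq)
  moreover have "\<forall>\<^sub>F x in at_right 0. c1 * (1 + x) ^ j < c2"
  proof -
    have "((\<lambda>x. c1 * (1 + x) ^ j) \<longlongrightarrow> c1 * (1 + 0) ^ j) (at_right 0)"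
      by (intro tendsto_intros)
    then show ?thesis using order_tendstoD(2) c2(1) by fastforce
  qed
  moreover have "\<forall>\<^sub>F x in at_right 0. \<bar>\<phi> x - x\<bar> < x ^ 2"
    using order_tendstoD(2)[OF tendsto_rabs_zero[OF flat[of 2]] zero_less_one] near
    by eventually_elim (simp add: pos_divide_less_eq)
  ultimately have "\<forall>\<^sub>F x in at_right 0. c2 * x ^ j < 1 - \<rho> x ^ Suc k \<and>
      c1 * (1 + x) ^ j < c2 \<and> \<bar>\<phi> x - x\<bar> < x ^ 2"
    by eventually_elim blast
  then obtain \<epsilon>2 where \<epsilon>2: "0 < \<epsilon>2"
    "\<And>x. 0 < x \<Longrightarrow> x < \<epsilon>2 \<Longrightarrow> c2 * x ^ j < 1 - \<rho> x ^ Suc k"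
    "\<And>x. 0 < x \<Longrightarrow> x < \<epsilon>2 \<Longrightarrow> c1 * (1 + x) ^ j < c2"
    "\<And>x. 0 < x \<Longrightarrow> x < \<epsilon>2 \<Longrightarrow> \<bar>\<phi> x - x\<bar> < x ^ 2"
    by (auto simp: eventually_at_right_field)
  \<comment> \<open>Halving \<open>\<epsilon>1\<close> covers mean-value points, which lie below
    \<open>2 * x\<close>; the bound \<open>1\<close> gives \<open>x * x < x\<close>.\<close>
  define \<epsilon> where "\<epsilon> = Min {\<delta>, \<epsilon>1 / 2, \<epsilon>2, 1}"
  have \<epsilon>: "0 < \<epsilon>" "\<epsilon> \<le> \<delta>" "2 * \<epsilon> \<le> \<epsilon>1" "\<epsilon> \<le> \<epsilon>2" "\<epsilon> \<le> 1"
    using contr(1) \<epsilon>1(1) \<epsilon>2(1) by (auto simp: \<epsilon>_def min_def)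

  define R where "R = (\<lambda>x. \<bar>\<phi> x - x\<bar> / x ^ Suc k)"
  have R_mono: "R x \<le> R (h x)" if x: "0 < x" "x < \<epsilon>" for x
  proof -
    have hx: "0 < h x" using contr(2) x \<epsilon> by auto
    \<comment> \<open>\<open>\<xi>\<close> lies within \<open>x ^ 2\<close> of \<open>x\<close>, so
      \<open>\<xi> \<le> x * (1 + x)\<close>, and passing from \<open>c1\<close> to
      \<open>c2\<close> absorbs the factor \<open>(1 + x) ^ j\<close>.\<close>
    have lower: "\<rho> x ^ Suc k \<le> deriv h \<xi>" if \<xi>: "\<bar>\<xi> - x\<bar> \<le> \<bar>\<phi> x - x\<bar>" for \<xi>
    proof -
      have "\<bar>\<phi> x - x\<bar> < x * x" using \<epsilon>2(4)[of x] x \<epsilon> by (simp add: power2_eq_square)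
      moreover have "x * x < x" using x \<epsilon> by simp
      ultimately have \<xi>': "0 < \<xi>" "\<xi> < \<epsilon>1" "\<xi> \<le> x * (1 + x)"
        using \<xi> x \<epsilon> unfolding distrib_left by linarith+
      have "\<xi> ^ j \<le> (x * (1 + x)) ^ j" using \<xi>' by (intro power_mono) auto
      then have "c1 * \<xi> ^ j \<le> c1 * (1 + x) ^ j * x ^ j"
        using \<open>0 < c1\<close> by (simp add: power_mult_distrib mult_ac)
      also have "\<dots> \<le> c2 * x ^ j"
        using \<epsilon>2(3)[of x] x \<epsilon> by (intro mult_right_mono) auto
      also have "\<dots> < 1 - \<rho> x ^ Suc k" using \<epsilon>2(2)[of x] x \<epsilon> by simp
      finally have "deriv r \<xi> < 1 - \<rho> x ^ Suc k" using \<epsilon>1(2)[of \<xi>] \<xi>' by simp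
      moreover have "deriv r \<xi> = 1 - deriv h \<xi>"
        unfolding r_def by (rule DERIV_imp_deriv) (auto intro!: derivative_eq_intros smooth_has_deriv h)
      ultimately show ?thesis by simp
    qed
    obtain \<xi> where \<xi>: "\<bar>\<xi> - x\<bar> \<le> \<bar>\<phi> x - x\<bar>" "h (\<phi> x) - h x = deriv h \<xi> * (\<phi> x - x)"
    proof -
      consider "\<phi> x = x" | "\<phi> x < x" | "x < \<phi> x" by linarith
      then show thesis
      proof cases
        case 1
        then show ?thesis using that[of x] by simp
      next
        case 2
        then obtain z where "\<phi> x < z" "z < x" "h x - h (\<phi> x) = (x - \<phi> x) * deriv h z"
          using MVT2[of "\<phi> x" x h "deriv h"] smooth_has_deriv[OF h(1)] by blast
        then show ?thesis using that[of z] by (simp add: algebra_simps)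
      next
        case 3
        then obtain z where "x < z" "z < \<phi> x" "h (\<phi> x) - h x = (\<phi> x - x) * deriv h z"
          using MVT2[of x "\<phi> x" h "deriv h"] smooth_has_deriv[OF h(1)] by blast
        then show ?thesis using that[of z] by (simp add: algebra_simps)
      qed
    qed
    \<comment> \<open>By commutation the displacement of \<open>\<phi>\<close> at \<open>h x\<close>
      is \<open>h (\<phi> x) - h x\<close>. It shrinks at most by the factor
      \<open>\<rho> x ^ Suc k\<close>, exactly the factor of the denominator of
      \<open>R\<close>.\<close>
    have "0 < \<rho> x" using hx x by (simp add: \<rho>_def)
    then have "\<rho> x ^ Suc k * \<bar>\<phi> x - x\<bar> \<le> \<bar>deriv h \<xi>\<bar> * \<bar>\<phi> x - x\<bar>"
      using lower[OF \<xi>(1)] by (intro mult_right_mono) auto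
    also have "\<dots> = \<bar>\<phi> (h x) - h x\<bar>" by (simp flip: abs_mult \<xi>(2) comm)
    finally have "h x ^ Suc k * \<bar>\<phi> x - x\<bar> \<le> \<bar>\<phi> (h x) - h x\<bar> * x ^ Suc k"
      using x by (simp add: \<rho>_def power_divide pos_divide_le_eq del: power_Suc)
    then show ?thesis
      unfolding R_def using x hx by (simp add: field_simps del: power_Suc)
  qed

  have "\<phi> x = x" if x: "0 < x" "x < \<epsilon>" for x
  proof -
    have contr': "0 < y \<Longrightarrow> y < \<epsilon> \<Longrightarrow> 0 < h y \<and> h y < y" for y
      using contr(2) \<epsilon> by simp
    note it = iterates_of_contraction_tendsto_0[OF smooth_isCont[OF h(1)] contr' x]
    \<comment> \<open>\<open>R\<close> does not decrease along the orbit, yet tends to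
      \<open>0\<close> along it by flatness.\<close>
    have "R x \<le> R ((h ^^ n) x)" for n
    proof (induction n)
      case (Suc n)
      also have "R ((h ^^ n) x) \<le> R ((h ^^ Suc n) x)" using R_mono it(1)[of n] by simp
      finally show ?case .
    qed simp
    moreover have "(\<lambda>n. R ((h ^^ n) x)) \<longlonglongrightarrow> 0"
    proof (rule filterlim_compose[of R])
      show "(R \<longlongrightarrow> 0) (at_right 0)"
      proof (rule Lim_transform_eventually)
        show "((\<lambda>x. \<bar>(\<phi> x - x) / x ^ Suc k\<bar>) \<longlongrightarrow> 0) (at_right 0)"
          by (intro tendsto_rabs_zero flat)
        show "\<forall>\<^sub>F x in at_right 0. \<bar>(\<phi> x - x) / x ^ Suc k\<bar> = R x"
          using near by eventually_elim (simp add: R_def)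
      qed
      show "filterlim (\<lambda>n. (h ^^ n) x) (at_right 0) sequentially"
        unfolding filterlim_at using it by (simp add: less_imp_neq[symmetric])
    qed
    ultimately have "R x \<le> 0" using LIMSEQ_le_const by blast
    moreover have "0 < x ^ Suc k" using x by (intro zero_less_power)
    ultimately show ?thesis by (simp add: R_def divide_le_0_iff del: power_Suc)
  qed
  then show ?thesis using \<epsilon>(1) by blast
qed

section \<open>Diffeomorphisms fixing the origin\<close>

lemma diffeo_plus_smooth: "diffeo_plus h \<Longrightarrow> smooth h"
  by (simp add: diffeo_plus_def diffeo_def)

lemma diffeo_plus_inv:
  assumes "diffeo_plus h"
  shows "diffeo_plus (inv h)"
proof -
  have h: "bij h" "smooth h" "smooth (inv h)" "strict_mono h"
    using assms by (auto simp: diffeo_plus_def diffeo_def)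
  have "strict_mono (inv h)"
  proof (rule strict_monoI)
    fix x y :: real assume "x < y"
    then show "inv h x < inv h y"
      using h(4) strict_mono_less[OF h(4), of "inv h x" "inv h y"] h(1)
      by (simp add: bij_is_surj surj_f_inv_f)
  qed
  then show ?thesis
    using h by (simp add: diffeo_plus_def diffeo_def bij_imp_bij_inv inv_inv_eq)
qed

lemma diffeo_plus_compose:
  assumes "diffeo_plus g" "diffeo_plus h"
  shows "diffeo_plus (\<lambda>x. g (h x))"
proof -
  have "inv (\<lambda>x. g (h x)) = (\<lambda>x. inv h (inv g x))"
    using o_inv_distrib[of g h] assms by (simp add: diffeo_plus_def diffeo_def comp_def)
  moreover have "bij (\<lambda>x. g (h x))"
    using bij_comp[of h g] assms by (simp add: diffeo_plus_def diffeo_def comp_def)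
  ultimately show ?thesis
    using assms by (simp add: diffeo_plus_def diffeo_def smooth_compose strict_mono_def)
qed

lemma taylor0_inv:
  assumes "diffeo h" "h 0 = 0"
  shows "taylor0 h oo taylor0 (inv h) = fps_X" "taylor0 (inv h) oo taylor0 h = fps_X"
proof -
  have inv: "h (inv h x) = x" "inv h (h x) = x" for x
    using assms(1) by (simp_all add: diffeo_def bij_is_surj surj_f_inv_f bij_is_inj)
  have h: "smooth h" "smooth (inv h)" using assms(1) by (simp_all add: diffeo_def)
  have "inv h 0 = 0" using inv(2)[of 0] assms(2) by simp
  then show "taylor0 h oo taylor0 (inv h) = fps_X" "taylor0 (inv h) oo taylor0 h = fps_X"
    using taylor0_compose[of h "inv h"] taylor0_compose[of "inv h" h] h assms(2)
    by (simp_all add: inv taylor0_ident)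
qed

lemma deriv_diffeo_neq_0:
  assumes "diffeo h" "h 0 = 0"
  shows "deriv h 0 \<noteq> 0"
proof -
  have "(taylor0 h oo taylor0 (inv h)) $ 1 = deriv h 0 * deriv (inv h) 0"
    by (simp add: fps_compose_nth taylor0_nth_1)
  then show ?thesis using taylor0_inv(1)[OF assms] by auto
qed

text \<open>Monotonicity only gives a nonnegative derivative; the smooth inverse excludes
  zero.\<close>

lemma deriv_diffeo_plus_pos:
  assumes "diffeo_plus h" "h 0 = 0"
  shows "0 < deriv h 0"
proof -
  have "mono_on UNIV h"
    using assms(1) by (auto simp: diffeo_plus_def strict_mono_mono)
  then have "0 \<le> deriv h 0"
    using mono_on_imp_deriv_nonneg[of UNIV h "deriv h 0" 0]
      smooth_has_deriv[OF diffeo_plus_smooth[OF assms(1)]] by simp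
  moreover have "deriv h 0 \<noteq> 0"
    using deriv_diffeo_neq_0 assms by (simp add: diffeo_plus_def)
  ultimately show ?thesis by simp
qed

lemma deriv_diffeo_minus_neg:
  assumes "diffeo_minus f" "f 0 = 0"
  shows "deriv f 0 < 0"
proof -
  have f: "smooth f" "\<And>x y. x < y \<Longrightarrow> f y < f x"
    using assms(1) by (auto simp: diffeo_minus_def diffeo_def)
  have "mono_on UNIV (\<lambda>x. - f x)"
    using f(2) by (auto simp: mono_on_def le_less)
  moreover have "((\<lambda>x. - f x) has_real_derivative - deriv f 0) (at 0)"
    using smooth_has_deriv[OF f(1)] by (rule DERIV_minus)
  ultimately have "0 \<le> - deriv f 0"
    using mono_on_imp_deriv_nonneg[of UNIV "\<lambda>x. - f x" "- deriv f 0" 0] by simp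
  moreover have "deriv f 0 \<noteq> 0"
    using deriv_diffeo_neq_0 assms by (simp add: diffeo_minus_def)
  ultimately show ?thesis by simp
qed

text \<open>The displacement is asymptotic to its first nonzero Taylor term, whose sign decides the
  alternative.\<close>

lemma displacement_sign_right:
  assumes "smooth h" "h 0 = 0" "taylor0 h \<noteq> fps_X"
  obtains \<delta> where "0 < \<delta>"
    "(\<forall>x. 0 < x \<and> x < \<delta> \<longrightarrow> h x < x) \<or> (\<forall>x. 0 < x \<and> x < \<delta> \<longrightarrow> x < h x)"
proof -
  define r where "r = (\<lambda>x. h x - x)"
  have r: "smooth r" by (simp add: r_def assms smooth_diff)
  have "taylor0 h = taylor0 r + fps_X"
    using taylor0_add[of r "\<lambda>x. x"] r taylor0_ident by (simp add: r_def)
  then have "taylor0 r \<noteq> 0" using assms(3) by auto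
  then obtain k u where u: "taylor0 r = fps_X ^ k * u" "u $ 0 \<noteq> 0"
    by (rule fps_subdegree_decompose[of _ 0]) auto
  have "((\<lambda>x. r x / x ^ k) \<longlongrightarrow> u $ 0) (at 0)"
    using taylor0_peano[OF r, of k] by (simp add: u fps_X_power_mult_nth)
  then have lim: "((\<lambda>x. r x / x ^ k) \<longlongrightarrow> u $ 0) (at_right 0)"
    by (simp add: filterlim_at_split)
  have pos: "\<forall>\<^sub>F x in at_right (0::real). 0 < x" by (rule eventually_at_right_less)
  consider "u $ 0 < 0" | "0 < u $ 0" using u by linarith
  then show thesis
  proof cases
    case 1
    have "\<forall>\<^sub>F x in at_right 0. h x < x"
      using order_tendstoD(2)[OF lim 1] pos
      by eventually_elim (auto simp: r_def divide_less_0_iff)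
    then show thesis using that by (auto simp: eventually_at_right_field)
  next
    case 2
    have "\<forall>\<^sub>F x in at_right 0. x < h x"
      using order_tendstoD(1)[OF lim 2] pos
      by eventually_elim (auto simp: r_def zero_less_divide_iff)
    then show thesis using that by (auto simp: eventually_at_right_field)
  qed
qed

text \<open>One of \<open>h\<close> and \<open>inv h\<close> contracts towards \<open>0\<close> from
  the right; both commute with \<open>\<phi>\<close> and have a Taylor series other than
  \<open>X\<close>.\<close>

lemma flat_commuting_with_nonflat_diffeo:
  assumes \<phi>: "smooth \<phi>" "taylor0 \<phi> = fps_X"
    and h: "diffeo_plus h" "h 0 = 0" "taylor0 h \<noteq> fps_X"
    and comm: "\<And>x. h (\<phi> x) = \<phi> (h x)"
  shows "\<exists>\<epsilon>>0. \<forall>x. 0 < x \<and> x < \<epsilon> \<longrightarrow> \<phi> x = x"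
proof -
  have inv: "h (inv h x) = x" "inv h (h x) = x" for x
    using h(1) by (simp_all add: diffeo_plus_def diffeo_def bij_is_surj surj_f_inv_f bij_is_inj)
  have sm: "strict_mono h" "strict_mono (inv h)"
    using h(1) diffeo_plus_inv by (auto simp: diffeo_plus_def)
  have inv0: "inv h 0 = 0" using inv(2)[of 0] h(2) by simp
  obtain \<delta> where \<delta>: "0 < \<delta>"
    "(\<forall>x. 0 < x \<and> x < \<delta> \<longrightarrow> h x < x) \<or> (\<forall>x. 0 < x \<and> x < \<delta> \<longrightarrow> x < h x)"
    using displacement_sign_right[OF diffeo_plus_smooth[OF h(1)] h(2,3)] by blast
  from \<delta>(2) show ?thesis
  proof
    assume "\<forall>x. 0 < x \<and> x < \<delta> \<longrightarrow> h x < x"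
    moreover have "0 < h x" if "0 < x" for x
      using strict_monoD[OF sm(1) that] h(2) by simp
    ultimately show ?thesis
      using flat_commuting_with_contraction[OF \<phi> diffeo_plus_smooth[OF h(1)] h(2)
          deriv_diffeo_plus_pos[OF h(1,2)] h(3) comm \<delta>(1)] by blast
  next
    assume *: "\<forall>x. 0 < x \<and> x < \<delta> \<longrightarrow> x < h x"
    have "inv h x < x" if "0 < x" "x < \<delta>" for x
      using * that strict_monoD[OF sm(2), of x "h x"] by (simp add: inv)
    moreover have "0 < inv h x" if "0 < x" for x
      using strict_monoD[OF sm(2) that] inv0 by simp
    moreover have "taylor0 (inv h) \<noteq> fps_X"
      using taylor0_inv(1)[of h] h by (auto simp: diffeo_plus_def)
    moreover have "inv h (\<phi> x) = \<phi> (inv h x)" for x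
      using comm[of "inv h x"] inv by metis
    ultimately show ?thesis
      using flat_commuting_with_contraction[OF \<phi>, of "inv h" \<delta>] inv0 \<delta>(1) diffeo_plus_inv[OF h(1)]
      by (simp add: diffeo_plus_smooth deriv_diffeo_plus_pos)
  qed
qed

section \<open>Diffeomorphisms supported near the origin\<close>

text \<open>The powers of \<open>1 / x\<close> are included so that derivatives of
  \<open>exp (- 1 / x)\<close>, extended by zero, are linear combinations of members of the
  family.\<close>

definition flat_exp :: "nat \<Rightarrow> real \<Rightarrow> real" where
  "flat_exp n x = (if x \<le> 0 then 0 else inverse x ^ n / exp (inverse x))"

lemma flat_exp_tendsto_0: "(flat_exp n \<longlongrightarrow> 0) (at 0)"
proof (rule filterlim_split_at)
  have "\<forall>\<^sub>F x in at_left 0. 0 = flat_exp n x"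
    by (auto simp: flat_exp_def eventually_at_filter)
  then show "(flat_exp n \<longlongrightarrow> 0) (at_left 0)"
    by (rule Lim_transform_eventually[OF tendsto_const])
  have "((\<lambda>x::real. inverse x ^ n / exp (inverse x)) \<longlongrightarrow> 0) (at_right 0)"
    by (rule filterlim_compose[OF tendsto_power_div_exp_0 filterlim_inverse_at_top_right])
  moreover have "\<forall>\<^sub>F x in at_right 0. inverse x ^ n / exp (inverse x) = flat_exp n x"
    by (auto simp: flat_exp_def eventually_at_filter)
  ultimately show "(flat_exp n \<longlongrightarrow> 0) (at_right 0)"
    by (rule Lim_transform_eventually)
qed

lemma flat_exp_has_deriv:
  "(flat_exp n has_real_derivative flat_exp (n + 2) x + (- real n) * flat_exp (n + 1) x) (at x)"
proof (cases x "0::real" rule: linorder_cases)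
  case less
  have "((\<lambda>x. 0) has_real_derivative 0) (at x)" by simp
  then have "(flat_exp n has_real_derivative 0) (at x)"
    by (rule has_field_derivative_transform_within_open[where S="{..<0}"])
       (use less in \<open>auto simp: flat_exp_def\<close>)
  then show ?thesis using less by (simp add: flat_exp_def)
next
  case equal
  \<comment> \<open>The difference quotient at \<open>0\<close> is \<open>flat_exp (Suc n)\<close>
    itself.\<close>
  have "((\<lambda>y. (flat_exp n y - flat_exp n 0) / (y - 0)) \<longlongrightarrow> 0) (at 0)"
  proof (rule Lim_transform_eventually[OF flat_exp_tendsto_0[of "Suc n"]])
    show "\<forall>\<^sub>F y in at 0. flat_exp (Suc n) y = (flat_exp n y - flat_exp n 0) / (y - 0)"
      by (intro always_eventually) (auto simp: flat_exp_def divide_inverse)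
  qed
  then show ?thesis using equal by (simp add: has_field_derivative_iff flat_exp_def)
next
  case greater
  define y where "y = inverse x"
  have y: "((\<lambda>x. inverse x) has_real_derivative - (y * y)) (at x)"
    using greater by (auto intro!: derivative_eq_intros simp: y_def)
  have "((\<lambda>x. inverse x ^ n) has_real_derivative - real n * y ^ (n + 1)) (at x)"
    using DERIV_power[OF y, of n] by (cases n) (simp_all add: y_def algebra_simps)
  moreover have "((\<lambda>x. exp (- inverse x)) has_real_derivative exp (- y) * - (- (y * y))) (at x)"
    using DERIV_chain2[OF DERIV_exp DERIV_minus[OF y]] by (simp add: y_def)
  ultimately have "((\<lambda>x. inverse x ^ n * exp (- inverse x)) has_real_derivative
      - real n * y ^ (n + 1) * exp (- inverse x) + exp (- y) * - (- (y * y)) * inverse x ^ n) (at x)"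
    by (rule DERIV_mult)
  moreover have "- real n * y ^ (n + 1) * exp (- inverse x) + exp (- y) * - (- (y * y)) * inverse x ^ n =
      flat_exp (n + 2) x + (- real n) * flat_exp (n + 1) x"
    using greater by (simp add: flat_exp_def y_def exp_minus divide_inverse algebra_simps)
  ultimately have "((\<lambda>x. inverse x ^ n / exp (inverse x)) has_real_derivative
      flat_exp (n + 2) x + (- real n) * flat_exp (n + 1) x) (at x)"
    by (simp add: exp_minus divide_inverse)
  then show ?thesis
    by (rule has_field_derivative_transform_within_open[where S="{0<..}"])
       (use greater in \<open>auto simp: flat_exp_def\<close>)
qed

lemma smooth_flat_exp: "smooth (flat_exp n)"
proof -
  have "diff_times k (flat_exp n)" for k n
  proof (induction k arbitrary: n)
    case (Suc k)
    show ?case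
      by (rule diff_timesI[OF flat_exp_has_deriv])
         (rule diff_times_add diff_times_mult diff_times_const Suc.IH)+
  qed simp
  then show ?thesis by (simp add: smooth_iff_diff_times)
qed

text \<open>The quotient \<open>step\<close> is \<open>0\<close> for \<open>t \<le> 0\<close> and
  \<open>1\<close> for \<open>t \<ge> 1\<close>; the substitution \<open>2 - 2 * (x * x)\<close>
  sends the outer and inner regions into these ranges.\<close>

lemma smooth_bump:
  obtains \<chi> :: "real \<Rightarrow> real" where "smooth \<chi>" "\<And>x. \<bar>\<chi> x\<bar> \<le> 1"
    "\<And>x. \<bar>x\<bar> \<le> 1 / 2 \<Longrightarrow> \<chi> x = 1" "\<And>x. 1 \<le> \<bar>x\<bar> \<Longrightarrow> \<chi> x = 0"
proof -
  define \<psi> where "\<psi> = flat_exp 0"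
  have \<psi>: "smooth \<psi>" "0 \<le> \<psi> t" "\<psi> t = 0 \<longleftrightarrow> t \<le> 0" for t
    using smooth_flat_exp by (auto simp: \<psi>_def flat_exp_def)
  define step where "step = (\<lambda>t. \<psi> t * inverse (\<psi> t + \<psi> (1 - t)))"
  have pos: "0 < \<psi> t + \<psi> (1 - t)" for t
    using \<psi>(2,3)[of t] \<psi>(2,3)[of "1 - t"] by linarith
  have step_smooth: "smooth step"
    unfolding step_def
  proof (rule smooth_mult[OF \<psi>(1) smooth_inverse])
    have "smooth (\<lambda>t. \<psi> (1 - t))"
      by (rule smooth_compose[OF \<psi>(1)]) (simp add: smooth_diff)
    with \<psi>(1) show "smooth (\<lambda>t. \<psi> t + \<psi> (1 - t))" by (rule smooth_add)
    show "\<psi> t + \<psi> (1 - t) \<noteq> 0" for t using pos[of t] by simp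
  qed
  show thesis
  proof
    show "smooth (\<lambda>x. step (2 - 2 * (x * x)))"
      by (rule smooth_compose[OF step_smooth]) (intro smooth_diff smooth_mult smooth_const smooth_ident)
    show "\<bar>step (2 - 2 * (x * x))\<bar> \<le> 1" for x
      using \<psi>(2) pos[of "2 - 2 * (x * x)"] by (simp add: step_def field_simps)
    show "step (2 - 2 * (x * x)) = 1" if "\<bar>x\<bar> \<le> 1 / 2" for x
    proof -
      have "\<bar>x\<bar> * \<bar>x\<bar> \<le> 1 / 2 * (1 / 2)" using that by (intro mult_mono) auto
      then have "1 \<le> 2 - 2 * (x * x)" by simp
      then show ?thesis using \<psi>(3)[of "1 - (2 - 2 * (x * x))"] pos[of "2 - 2 * (x * x)"]
        by (simp add: step_def)
    qed
    show "step (2 - 2 * (x * x)) = 0" if "1 \<le> \<bar>x\<bar>" for x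
    proof -
      have "1 * 1 \<le> \<bar>x\<bar> * \<bar>x\<bar>" using that by (intro mult_mono) auto
      then show ?thesis using \<psi>(3)[of "2 - 2 * (x * x)"] by (simp add: step_def)
    qed
  qed
qed

text \<open>Surjectivity comes from the intermediate value theorem inside
  \<open>[-\<delta>, \<delta>]\<close> and from \<open>h x = x\<close> outside.\<close>

lemma diffeo_plus_of_deriv_pos:
  fixes h :: "real \<Rightarrow> real"
  assumes "smooth h" "\<And>x. 0 < deriv h x" "\<And>x. \<delta> \<le> \<bar>x\<bar> \<Longrightarrow> h x = x" "0 < \<delta>"
  shows "diffeo_plus h"
proof -
  have sm: "strict_mono h"
    by (rule strict_monoI, erule DERIV_pos_imp_increasing)
       (use smooth_has_deriv[OF assms(1)] assms(2) in blast)
  have "\<exists>x. h x = y" for y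
  proof (cases "\<bar>y\<bar> \<le> \<delta>")
    case True
    then have "\<exists>x\<ge>- \<delta>. x \<le> \<delta> \<and> h x = y"
      using assms by (intro IVT') (auto simp: smooth_isCont continuous_at_imp_continuous_on)
    then show ?thesis by blast
  next
    case False
    then show ?thesis using assms(3)[of y] by auto
  qed
  then have "surj h" unfolding surj_def by metis
  with strict_mono_imp_inj_on[OF sm] have "bij h" by (rule bijI)
  moreover from this assms(1) have "smooth (inv h)"
    by (rule smooth_inv) (use assms(2) less_irrefl in metis)
  ultimately show ?thesis
    using sm assms(1) by (simp add: diffeo_plus_def diffeo_def)
qed

text \<open>Cut \<open>e\<close> off at a small scale \<open>\<delta>\<close>. There
  \<open>e\<close> is at most \<open>\<eta> * \<delta>\<close>, which compensates the factor
  \<open>1 / \<delta>\<close> from differentiating the rescaled cutoff, so the derivative of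
  \<open>h\<close> stays positive.\<close>

lemma localized_diffeo:
  assumes e: "smooth e" "e 0 = 0" "deriv e 0 = 0" and "0 < \<epsilon>"
  obtains h where "diffeo_plus h" "\<forall>\<^sub>F x in nhds 0. h x = x + e x" "\<And>x. \<epsilon> \<le> \<bar>x\<bar> \<Longrightarrow> h x = x"
proof -
  obtain \<chi> :: "real \<Rightarrow> real" where \<chi>: "smooth \<chi>" "\<And>x. \<bar>\<chi> x\<bar> \<le> 1"
    "\<And>x. \<bar>x\<bar> \<le> 1 / 2 \<Longrightarrow> \<chi> x = 1" "\<And>x. 1 \<le> \<bar>x\<bar> \<Longrightarrow> \<chi> x = 0"
    using smooth_bump by blast
  have "bounded (deriv \<chi> ` {-1..1})"
    using \<chi>(1) by (intro compact_imp_bounded compact_continuous_image)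
      (auto intro!: continuous_at_imp_continuous_on smooth_isCont smooth_deriv)
  then obtain M where M: "0 < M" "\<And>x. \<bar>x\<bar> \<le> 1 \<Longrightarrow> \<bar>deriv \<chi> x\<bar> \<le> M"
    unfolding bounded_pos by (auto simp: abs_le_iff)
  \<comment> \<open>Chosen so that the two terms in the derivative of the perturbation, bounded by
    \<open>M * \<eta>\<close> and \<open>\<eta>\<close>, contribute at most
    \<open>1 / 2\<close>.\<close>
  define \<eta> where "\<eta> = 1 / (2 * (M + 1))"
  have \<eta>: "0 < \<eta>" "M * \<eta> + \<eta> = 1 / 2" using M(1) by (simp_all add: \<eta>_def field_simps)
  have "deriv e \<midarrow>0\<rightarrow> 0"
    using smooth_isCont[OF smooth_deriv[OF e(1)], of 0] e(3) by (simp add: isCont_def)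
  from LIM_D[OF this \<eta>(1)]
  obtain d where d: "0 < d" "\<And>x. x \<noteq> 0 \<Longrightarrow> \<bar>x\<bar> < d \<Longrightarrow> \<bar>deriv e x\<bar> < \<eta>" by auto
  define \<delta> where "\<delta> = min \<epsilon> (d / 2)"
  have \<delta>: "0 < \<delta>" "\<delta> \<le> \<epsilon>" "\<delta> < d" using d \<open>0 < \<epsilon>\<close> by (auto simp: \<delta>_def)
  have de: "\<bar>deriv e x\<bar> \<le> \<eta>" if "\<bar>x\<bar> \<le> \<delta>" for x
    using d(2)[of x] that \<delta> e(3) \<eta>(1) by (cases "x = 0") auto
  have e_le: "\<bar>e x\<bar> \<le> \<eta> * \<delta>" if "\<bar>x\<bar> \<le> \<delta>" for x
  proof -
    have "norm (e x - e 0) \<le> \<eta> * norm (x - 0)"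
    proof (rule field_differentiable_bound[where S="{- \<delta>..\<delta>}" and f'="deriv e"])
      show "(e has_field_derivative deriv e z) (at z within {- \<delta>..\<delta>})" for z
        using smooth_has_deriv[OF e(1)] by (rule has_field_derivative_at_within)
    qed (use de that \<delta> in \<open>auto simp: abs_le_iff\<close>)
    also have "\<dots> \<le> \<eta> * \<delta>" using that \<eta> by simp
    finally show ?thesis by (simp add: e)
  qed

  define h where "h = (\<lambda>x. x + \<chi> (inverse \<delta> * x) * e x)"
  have outside: "h x = x" if "\<delta> \<le> \<bar>x\<bar>" for x
    using \<chi>(4)[of "inverse \<delta> * x"] that \<delta> by (simp add: h_def abs_mult field_simps)
  have smooth_h: "smooth h"
    unfolding h_def
    by (intro smooth_add smooth_mult smooth_ident e(1) smooth_compose[OF \<chi>(1)] smooth_const)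
  have "0 < deriv h x" for x
  proof (cases "\<bar>x\<bar> \<le> \<delta>")
    case True
    define y where "y = inverse \<delta> * x"
    have y: "\<bar>y\<bar> \<le> 1" using True \<delta> by (simp add: y_def abs_mult field_simps)
    have "((\<lambda>x. \<chi> (inverse \<delta> * x)) has_real_derivative deriv \<chi> y * inverse \<delta>) (at x)"
      unfolding y_def
      by (rule DERIV_chain2[OF smooth_has_deriv[OF \<chi>(1)]]) (auto intro!: derivative_eq_intros)
    then have "(h has_real_derivative
        1 + (deriv \<chi> y * inverse \<delta> * e x + deriv e x * \<chi> y)) (at x)"
      unfolding h_def y_def
      by (intro DERIV_add DERIV_ident DERIV_mult smooth_has_deriv[OF e(1)])
    then have dh: "deriv h x = 1 + (deriv \<chi> y * inverse \<delta> * e x + deriv e x * \<chi> y)"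
      by (rule DERIV_imp_deriv)
    have "\<bar>deriv \<chi> y * inverse \<delta> * e x\<bar> = \<bar>deriv \<chi> y\<bar> * (inverse \<delta> * \<bar>e x\<bar>)"
      using \<delta> by (simp add: abs_mult)
    also have "\<dots> \<le> M * \<eta>"
      using M(1) M(2)[OF y] e_le[OF True] \<delta> by (intro mult_mono) (auto simp: field_simps)
    finally have 1: "\<bar>deriv \<chi> y * inverse \<delta> * e x\<bar> \<le> M * \<eta>" .
    have "\<bar>deriv e x * \<chi> y\<bar> \<le> \<eta> * 1"
      unfolding abs_mult using de[OF True] \<chi>(2)[of y] \<eta>(1) by (intro mult_mono) auto
    with 1 \<eta>(2) show ?thesis unfolding dh by linarith
  next
    case False
    have "open {x. \<delta> < \<bar>x::real\<bar>}" by (intro open_Collect_less continuous_intros)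
    then have "(h has_real_derivative 1) (at x)"
      by (rule has_field_derivative_transform_within_open[OF DERIV_ident])
         (use False outside in auto)
    then show ?thesis by (simp add: DERIV_imp_deriv)
  qed
  then have "diffeo_plus h"
    using diffeo_plus_of_deriv_pos smooth_h outside \<delta>(1) by blast
  moreover have "\<forall>\<^sub>F x in nhds 0. h x = x + e x"
  proof -
    have "\<forall>\<^sub>F x in nhds 0. x \<in> {- \<delta> / 2<..<\<delta> / 2}"
      using \<delta> by (intro eventually_nhds_in_open) auto
    then show ?thesis
    proof eventually_elim
      case (elim x)
      then have "\<bar>inverse \<delta> * x\<bar> \<le> 1 / 2" using \<delta> by (auto simp: abs_mult field_simps)
      then show ?case using \<chi>(3) by (simp add: h_def)
    qed
  qed
  ultimately show thesis
    by (rule that) (use outside \<delta>(2) in force)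
qed

text \<open>\<open>h\<close> fixes both endpoints and so preserves the interval where
  \<open>\<phi>\<close> is the identity; \<open>\<phi>\<close>, being injective, maps the complement
  into itself, where \<open>h\<close> is the identity.\<close>

lemma commute_of_complementary_supports:
  fixes \<phi> h :: "real \<Rightarrow> real"
  assumes \<phi>: "inj \<phi>" "\<And>x. \<bar>x\<bar> \<le> \<epsilon> \<Longrightarrow> \<phi> x = x"
    and h: "strict_mono h" "\<And>x. \<epsilon> \<le> \<bar>x\<bar> \<Longrightarrow> h x = x" and "0 < \<epsilon>"
  shows "h (\<phi> x) = \<phi> (h x)"
proof (cases "\<bar>x\<bar> \<le> \<epsilon>")
  case True
  then have "h (- \<epsilon>) \<le> h x" "h x \<le> h \<epsilon>"
    by (auto simp: strict_mono_less_eq[OF h(1)])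
  then have "\<bar>h x\<bar> \<le> \<epsilon>" using h(2)[of \<epsilon>] h(2)[of "- \<epsilon>"] \<open>0 < \<epsilon>\<close> by simp
  then show ?thesis using True \<phi>(2) by simp
next
  case False
  then have "\<phi> (\<phi> x) \<noteq> \<phi> x" if "\<bar>\<phi> x\<bar> \<le> \<epsilon>"
    using that \<phi>(1) injD by fastforce
  then have "\<epsilon> \<le> \<bar>\<phi> x\<bar>" using \<phi>(2) by force
  then show ?thesis using False h(2) by simp
qed

section \<open>Orientation-reversing square roots\<close>

text \<open>
  When \<open>f \<circ> f\<close> is the identity near \<open>0\<close>, the chart \<open>x \<mapsto> (x - f x) / 2\<close> conjugates \<open>f\<close> to \<open>x \<mapsto> - x\<close> near \<open>0\<close>.
\<close>
lemma linearizing_diffeo: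
  assumes f: "diffeo_minus f" "f 0 = 0" and \<epsilon>: "0 < \<epsilon>" "\<And>x. \<bar>x\<bar> \<le> \<epsilon> \<Longrightarrow> f (f x) = x"
  obtains h where "diffeo_plus h" "h 0 = 0" "\<And>x. h (f (f x)) = f (f (h x))"
    "taylor0 h oo taylor0 f = - taylor0 h"
proof -
  have sf: "smooth f" and bf: "bij f" using f by (auto simp: diffeo_minus_def diffeo_def)
  have near: "\<forall>\<^sub>F x in nhds 0. f (f x) = x"
  proof -
    have "\<forall>\<^sub>F x in nhds 0. x \<in> {- \<epsilon><..<\<epsilon>}"
      using \<epsilon> by (intro eventually_nhds_in_open) auto
    then show ?thesis by eventually_elim (use \<epsilon>(2) in auto)
  qed
  have "taylor0 f oo taylor0 f = fps_X"
    using taylor0_compose[OF sf sf f(2)] taylor0_cong[OF near] by (simp add: taylor0_ident)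
  then have "(taylor0 f oo taylor0 f) $ 1 = 1" by simp
  then have "(deriv f 0)\<^sup>2 = 1"
    by (simp add: fps_compose_nth taylor0_nth_1 power2_eq_square)
  then have df: "deriv f 0 = -1"
    using deriv_diffeo_minus_neg[OF f] by (auto simp: power2_eq_1_iff)
  \<comment> \<open>With this choice \<open>x + e x\<close> is the chart
    \<open>(x - f x) / 2\<close>, and \<open>deriv f 0 = -1\<close> makes the derivative of
    \<open>e\<close> vanish at \<open>0\<close>.\<close>
  define e where "e = (\<lambda>x. - (1 / 2) * (x + f x))"
  have e: "smooth e" unfolding e_def by (intro smooth_mult smooth_add smooth_const smooth_ident sf)
  have "(e has_real_derivative - (1 / 2) * (1 + deriv f 0)) (at 0)"
    unfolding e_def by (auto intro!: derivative_eq_intros smooth_has_deriv sf)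
  then have "deriv e 0 = 0" using df by (simp add: DERIV_imp_deriv)
  moreover have "e 0 = 0" by (simp add: e_def f)
  ultimately obtain h where h: "diffeo_plus h" "\<forall>\<^sub>F x in nhds 0. h x = x + e x"
      "\<And>x. \<epsilon> \<le> \<bar>x\<bar> \<Longrightarrow> h x = x"
    using localized_diffeo[OF e _ _ \<epsilon>(1)] by blast
  show thesis
  proof
    show "diffeo_plus h" by (fact h)
    show h0: "h 0 = 0" using eventually_nhds_x_imp_x[OF h(2)] \<open>e 0 = 0\<close> by simp
    show "h (f (f x)) = f (f (h x))" for x
    proof (rule commute_of_complementary_supports[where \<phi>="\<lambda>x. f (f x)"])
      show "inj (\<lambda>x. f (f x))" using bf by (auto simp: inj_def bij_def)
      show "strict_mono h" using h(1) by (simp add: diffeo_plus_def)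
    qed (use \<epsilon> h in auto)
    \<comment> \<open>The local formula for \<open>h\<close> is also evaluated at
      \<open>f x\<close>, where \<open>f (f x) = x\<close> flips the sign of the chart.\<close>
    have "filterlim f (nhds 0) (nhds 0)"
      using smooth_isCont[OF sf, of 0] f(2) by (simp add: continuous_at tendsto_nhds_iff)
    with h(2) have "\<forall>\<^sub>F x in nhds 0. h (f x) = f x + e (f x)"
      by (rule eventually_compose_filterlim)
    with h(2) near have "\<forall>\<^sub>F x in nhds 0. h (f x) = - h x"
      by eventually_elim (simp add: e_def field_simps)
    then have "taylor0 (\<lambda>x. h (f x)) = taylor0 (\<lambda>x. - 1 * h x)"
      by (intro taylor0_cong) (simp add: eventually_mono)
    also have "\<dots> = fps_const (- 1) * taylor0 h"
      by (simp only: taylor0_mult[OF smooth_const diffeo_plus_smooth[OF h(1)]] taylor0_const)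
    also have "\<dots> = - taylor0 h" by (rule fps_ext) simp
    finally show "taylor0 h oo taylor0 f = - taylor0 h"
      using taylor0_compose[OF diffeo_plus_smooth[OF h(1)] sf f(2)] by simp
  qed
qed

section \<open>Conjugacy of the Taylor series and the fixed points of the common square\<close>

theorem theorem2p3:
  fixes f g :: "real \<Rightarrow> real"
  assumes "diffeo_minus f" and "diffeo_minus g"
    and "f 0 = 0" and "g 0 = 0"
    and "f \<circ> f = g \<circ> g"
  shows "(\<exists>h. diffeo_plus h \<and> h 0 = 0 \<and> h \<circ> (f \<circ> f) = (f \<circ> f) \<circ> h \<and>
            taylor0 f = fps_inv (taylor0 h) oo (taylor0 g oo taylor0 h))
     \<longleftrightarrow> (taylor0 f oo taylor0 f \<noteq> fps_X
          \<or> 0 \<in> interior {x. f (f x) = x}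
          \<or> (taylor0 f oo taylor0 f = fps_X \<and> 0 \<in> frontier {x. f (f x) = x}
             \<and> taylor0 f = taylor0 g))"
    (is "(\<exists>h. ?conj h) \<longleftrightarrow> ?cases")
proof -
  have sf: "smooth f" "smooth g" and bf: "bij f"
    using assms by (auto simp: diffeo_minus_def diffeo_def)
  have gg: "g (g x) = f (f x)" for x using assms(5) by (metis comp_apply)
  have sq: "taylor0 f oo taylor0 f = taylor0 (\<lambda>x. f (f x))" "taylor0 g oo taylor0 g = taylor0 (\<lambda>x. f (f x))"
    using taylor0_compose[of f f] taylor0_compose[of g g] sf assms(3,4) by (simp_all add: gg)
  have fix0: "0 \<in> {x. f (f x) = x}" using assms(3) by simp
  have conj_ident: "fps_inv fps_X oo (taylor0 g oo fps_X) = taylor0 g"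
    using fps_inv[of "fps_X :: real fps"] assms(4) by (simp add: fps_X_fps_compose_startby0)

  show ?thesis
  proof
    assume "\<exists>h. ?conj h"
    then obtain h where h: "diffeo_plus h" "h 0 = 0" "h \<circ> (f \<circ> f) = (f \<circ> f) \<circ> h"
      "taylor0 f = fps_inv (taylor0 h) oo (taylor0 g oo taylor0 h)" by blast
    have comm: "h (f (f x)) = f (f (h x))" for x using h(3) by (metis comp_apply)
    show ?cases
    proof (rule ccontr)
      assume neg: "\<not> ?cases"
      then have flat: "taylor0 (\<lambda>x. f (f x)) = fps_X" using sq by simp
      \<comment> \<open>\<open>0\<close> is itself fixed, so failing to be interior puts it on the
        boundary; the negated third case then separates the two Taylor series.\<close>
      have "0 \<in> frontier {x. f (f x) = x}"
        using neg fix0 subsetD[OF closure_subset fix0] by (simp only: frontier_def Diff_iff) simp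
      then have "taylor0 f \<noteq> taylor0 g" using neg by simp
      then have "taylor0 h \<noteq> fps_X" using h(4) conj_ident by auto
      then obtain \<epsilon> where \<epsilon>: "0 < \<epsilon>" "\<And>x. 0 < x \<Longrightarrow> x < \<epsilon> \<Longrightarrow> f (f x) = x"
        using flat_commuting_with_nonflat_diffeo[OF smooth_compose[OF sf(1) sf(1)] flat h(1,2) _ comm]
        by blast
      have \<comment> \<open>\<open>f\<close> carries the fixed points of \<open>f \<circ> f\<close> on the right of \<open>0\<close> to the left.\<close>
        left: "f (f x) = x" if "f (\<epsilon> / 2) < x" "x < 0" for x
      proof -
        obtain y where y: "f y = x" using bf by (metis bij_pointE)
        have anti: "a < b" if "f b < f a" for a b
          using that assms(1) unfolding diffeo_minus_def by (metis less_asym linorder_neqE_linordered_idom)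
        have "0 < y" by (rule anti) (use that y assms(3) in simp)
        moreover have "y < \<epsilon> / 2" by (rule anti) (use that y in simp)
        ultimately have "f (f y) = y" using \<epsilon> by simp
        then show ?thesis using y by simp
      qed
      have "f (\<epsilon> / 2) < f 0"
        using assms(1) \<epsilon>(1) unfolding diffeo_minus_def by (metis half_gt_zero)
      then have zero: "0 \<in> {f (\<epsilon> / 2)<..<\<epsilon>}" using \<epsilon>(1) assms(3) by simp
      have "f (f x) = x" if "x \<in> {f (\<epsilon> / 2)<..<\<epsilon>}" for x
        by (cases x "0::real" rule: linorder_cases) (use that left \<epsilon>(2) assms(3) in simp_all)
      then have "{f (\<epsilon> / 2)<..<\<epsilon>} \<subseteq> {x. f (f x) = x}" by blast
      with zero have "0 \<in> interior {x. f (f x) = x}"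
        by (rule interiorI[OF open_greaterThanLessThan])
      then show False using neg by simp
    qed
  next
    assume cases: ?cases
    \<comment> \<open>The first and third cases both reduce to equal Taylor series, where the
      identity serves as \<open>h\<close>.\<close>
    have ident: "\<exists>h. ?conj h" if "taylor0 f = taylor0 g"
    proof (intro exI[of _ "\<lambda>x. x"] conjI)
      show "diffeo_plus (\<lambda>x. x)"
        by (intro diffeo_plus_of_deriv_pos[of _ 1]) auto
    qed (use that conj_ident in \<open>auto simp: taylor0_ident\<close>)
    from cases show "\<exists>h. ?conj h"
    proof (elim disjE conjE)
      assume "taylor0 f oo taylor0 f \<noteq> fps_X"
      then show ?thesis
        using fps_reversing_square_root_unique[of "taylor0 f" "taylor0 g"] sq assms
          deriv_diffeo_minus_neg[of f] deriv_diffeo_minus_neg[of g]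
        by (intro ident) (simp add: taylor0_nth_1)
    next
      assume "0 \<in> interior {x. f (f x) = x}"
      then obtain \<epsilon> where \<epsilon>: "0 < \<epsilon>" "cball 0 \<epsilon> \<subseteq> {x. f (f x) = x}"
        by (auto simp: mem_interior_cball)
      then have fixed: "f (f x) = x" if "\<bar>x\<bar> \<le> \<epsilon>" for x using that by auto
      obtain h1 where h1: "diffeo_plus h1" "h1 0 = 0" "\<And>x. h1 (f (f x)) = f (f (h1 x))"
          "taylor0 h1 oo taylor0 f = - taylor0 h1"
        using linearizing_diffeo[OF assms(1,3) \<epsilon>(1) fixed] by blast
      obtain h2 where h2: "diffeo_plus h2" "h2 0 = 0" "\<And>x. h2 (g (g x)) = g (g (h2 x))"
          "taylor0 h2 oo taylor0 g = - taylor0 h2"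
        using linearizing_diffeo[OF assms(2,4) \<epsilon>(1)] fixed gg by (metis (no_types, lifting))
      have inv2: "h2 (inv h2 x) = x" "inv h2 (h2 x) = x" for x
        using h2(1) by (simp_all add: diffeo_plus_def diffeo_def bij_is_surj surj_f_inv_f bij_is_inj)
      have inv20: "inv h2 0 = 0" using inv2(2)[of 0] h2(2) by simp
      \<comment> \<open>The series of \<open>h1\<close> and \<open>h2\<close> conjugate those of
        \<open>f\<close> and \<open>g\<close> to \<open>- X\<close>; \<open>h\<close> goes through
        this common normal form.\<close>
      define h where "h = (\<lambda>x. inv h2 (h1 x))"
      have h: "diffeo_plus h" "h 0 = 0"
        using h1 h2 by (simp_all add: h_def diffeo_plus_compose diffeo_plus_inv inv20)
      have "h (f (f x)) = f (f (h x))" for x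
        using h2(3)[of "h x"] by (metis gg h1(3) h_def inv2)
      then have comm: "h \<circ> (f \<circ> f) = (f \<circ> f) \<circ> h" by auto
      define F G H H1 H2 where "F = taylor0 f" "G = taylor0 g" "H = taylor0 h"
        "H1 = taylor0 h1" "H2 = taylor0 h2"
      note defs = F_G_H_H1_H2_def
      have zero: "F $ 0 = 0" "G $ 0 = 0" "H $ 0 = 0" "H1 $ 0 = 0" "H2 $ 0 = 0"
        using assms h h1 h2 by (simp_all add: defs)
      have "H $ 1 \<noteq> 0" using deriv_diffeo_plus_pos[OF h] by (simp add: defs taylor0_nth_1)
      have H2H: "H2 oo H = H1"
        using taylor0_compose[of h2 h] h h2(1) by (simp add: defs h_def inv2 diffeo_plus_smooth)
      \<comment> \<open>Both sides equal \<open>- H1\<close>, since \<open>H2 oo G = - H2\<close>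
        and \<open>H1 oo F = - H1\<close>. Composing with the series of \<open>inv h2\<close> then
        cancels \<open>H2\<close>.\<close>
      have "H2 oo (G oo H) = H2 oo (H oo F)"
        using h1(4) h2(4) zero H2H by (simp add: fps_compose_assoc fps_compose_uminus flip: defs)
      then have "(taylor0 (inv h2) oo H2) oo (G oo H) = (taylor0 (inv h2) oo H2) oo (H oo F)"
        using zero by (simp flip: fps_compose_assoc)
      moreover have "taylor0 (inv h2) oo H2 = fps_X"
        unfolding defs using h2 by (intro taylor0_inv) (simp_all add: diffeo_plus_def)
      ultimately have "G oo H = H oo F" using zero by (simp add: fps_X_fps_compose_startby0)
      then have "fps_inv H oo (G oo H) = (fps_inv H oo H) oo F"
        using zero by (simp add: fps_compose_assoc)
      also have "\<dots> = F"
        using fps_inv[OF zero(3) \<open>H $ 1 \<noteq> 0\<close>] zero by (simp add: fps_X_fps_compose_startby0)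
      finally have "taylor0 f = fps_inv (taylor0 h) oo (taylor0 g oo taylor0 h)"
        by (simp add: defs)
      with h comm show ?thesis by blast
    qed (rule ident)
  qed
qed

end
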